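(* Let $\mathcal K$ be an $n$-maniplex. All the universal Cayley extensions $\mathcal U(\mathcal K,r_n)$ of $\mathcal K$ (over all pre-extenders $(\mathcal K,r_n)$) are isomorphic to each other if and only if every isomorphism between two different facets of $\mathcal K$, as well as every involutory automorphism of a facet of $\mathcal K$, can be extended to an automorphism of $\mathcal K$. In this case, $\Gamma(\mathcal K)$ is $r_n$-friendly for every pre-extender $(\mathcal K,r_n)$.
   Context: An $n$-premaniplex is a graph (semi-edges and parallel edges allowed) whose vertices, called flags, carry a proper edge colouring with colours $0,\dots,n-1$, each flag $\Phi$ having exactly one incident dart of each colour $i$, with other end $r_i\Phi$; one requires $r_ir_jr_ir_j=1$ for $|i-j|>1$. An $n$-maniplex is a connected $n$-premaniplex in which $r_i$ and $r_ir_j$ ($i\ne j$) have no fixed points. Facets are components after deleting colour-$(n-1)$ edges (coloured graphs with colours $0,\dots,n-2$). Automorphisms/isomorphisms are colour-preserving, automorphisms act on the right, $\Gamma(\mathcal K)$ is the automorphism group. An isomorphism $\sigma$ between facets $F,F'$ extends to an automorphism of $\mathcal K$ if there is $\tau\in\Gamma(\mathcal K)$ with $\Phi\tau=\Phi\sigma$ for all flags $\Phi$ of $F$. A pre-extender $(\mathcal K,r_n)$ is a permutation $r_n$ of the flags of $\mathcal K$ with $r_n^2=1$ commuting with $r_0,\dots,r_{n-2}$ (so it maps each facet $F$ isomorphically onto a facet $r_n(F)$). The universal Cayley extension $\mathcal U(\mathcal K,r_n)$ is the maniplex with flags $(\Phi,\gamma)$, $\Phi$ a flag of $\mathcal K$,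 $\gamma\in G(\mathcal K,r_n)=\langle\alpha_F\ (F\text{ a facet})\mid \alpha_F\alpha_{r_n(F)}=1\rangle$, where $(\Phi,\gamma)$ is $i$-adjacent to $(r_i\Phi,\gamma)$ for $i<n$ and $n$-adjacent to $(r_n\Phi,\alpha_F\gamma)$, $F$ the facet of $\Phi$. A subset $S\subseteq\Gamma(\mathcal K)$ is $r_n$-friendly if for every flag $\Phi$ and every $\tau\in S$ there is $\bar\tau\in S$ with $r_n(\Phi\tau)=(r_n\Phi)\bar\tau$. *)

theory Defs
  imports "HOL-Algebra.Group"
begin

section \<open>Premaniplexes and maniplexes\<close>

text \<open>
  A properly edge-coloured graph in which each flag has exactly one dart of each colour is given by
  the involutions sending a flag to the other end of its dart of colour \<open>i\<close>; fixed points are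
  semi-edges. The rank is not part of the record: a predicate with rank argument \<open>n\<close> only
  looks at the colours \<open>i < n\<close>.
\<close>

record 'a flag_graph =
  flags :: "'a set"
  adj :: "nat \<Rightarrow> 'a \<Rightarrow> 'a"

locale premaniplex =
  fixes n :: nat and K :: "'a flag_graph"
  assumes adj_closed: "\<And>i \<Phi>. i < n \<Longrightarrow> \<Phi> \<in> flags K \<Longrightarrow> adj K i \<Phi> \<in> flags K"
    and adj_invol: "\<And>i \<Phi>. i < n \<Longrightarrow> \<Phi> \<in> flags K \<Longrightarrow> adj K i (adj K i \<Phi>) = \<Phi>"
    and adj_square: "\<And>i j \<Phi>. i < n \<Longrightarrow> j < n \<Longrightarrow> \<bar>int i - int j\<bar> > 1 \<Longrightarrow> \<Phi> \<in> flags K \<Longrightarrow>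
      adj K i (adj K j (adj K i (adj K j \<Phi>))) = \<Phi>"

definition component :: "nat \<Rightarrow> 'a flag_graph \<Rightarrow> 'a \<Rightarrow> 'a set" where
  "component m K \<Phi> = {\<Psi>. (\<lambda>x y. \<exists>i<m. y = adj K i x)\<^sup>*\<^sup>* \<Phi> \<Psi>}"

locale maniplex = premaniplex +
  assumes nonempty: "flags K \<noteq> {}"
    and connected: "\<And>\<Phi> \<Psi>. \<Phi> \<in> flags K \<Longrightarrow> \<Psi> \<in> flags K \<Longrightarrow> \<Psi> \<in> component n K \<Phi>"
    and adj_no_fixpoint: "\<And>i \<Phi>. i < n \<Longrightarrow> \<Phi> \<in> flags K \<Longrightarrow> adj K i \<Phi> \<noteq> \<Phi>"
    and adj_adj_no_fixpoint: "\<And>i j \<Phi>. i < n \<Longrightarrow> j < n \<Longrightarrow> i \<noteq> j \<Longrightarrow> \<Phi> \<in> flags K \<Longrightarrow>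
      adj K i (adj K j \<Phi>) \<noteq> \<Phi>"

text \<open>
  A facet is identified with its set \<open>F\<close> of flags; as a coloured graph it is
  \<open>K\<lparr>flags := F\<rparr>\<close>, taken with the colours below \<open>n - 1\<close>.
\<close>

definition facet_of :: "nat \<Rightarrow> 'a flag_graph \<Rightarrow> 'a \<Rightarrow> 'a set" where
  "facet_of n K \<Phi> = component (n - 1) K \<Phi>"

definition facets :: "nat \<Rightarrow> 'a flag_graph \<Rightarrow> 'a set set" where
  "facets n K = facet_of n K ` flags K"

text \<open>
  Isomorphisms are taken to be \<open>undefined\<close> off the flag set, so that they are determined by
  their action on flags. The right action \<open>\<Phi>\<tau>\<close> is written as the application
  \<open>\<tau> \<Phi>\<close>.
\<close>

definition isos :: "nat \<Rightarrow> 'a flag_graph \<Rightarrow> 'b flag_graph \<Rightarrow> ('a \<Rightarrow> 'b) set" where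
  "isos n K L = {\<sigma> \<in> extensional (flags K). bij_betw \<sigma> (flags K) (flags L) \<and>
     (\<forall>i<n. \<forall>\<Phi>\<in>flags K. \<sigma> (adj K i \<Phi>) = adj L i (\<sigma> \<Phi>))}"

abbreviation automorphisms :: "nat \<Rightarrow> 'a flag_graph \<Rightarrow> ('a \<Rightarrow> 'a) set" where
  "automorphisms n K \<equiv> isos n K K"

definition isomorphic :: "nat \<Rightarrow> 'a flag_graph \<Rightarrow> 'b flag_graph \<Rightarrow> bool" where
  "isomorphic n K L \<longleftrightarrow> isos n K L \<noteq> {}"

definition facet_isos :: "nat \<Rightarrow> 'a flag_graph \<Rightarrow> 'a set \<Rightarrow> 'a set \<Rightarrow> ('a \<Rightarrow> 'a) set" where
  "facet_isos n K F F' = isos (n - 1) (K\<lparr>flags := F\<rparr>) (K\<lparr>flags := F'\<rparr>)"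

definition extends_to_automorphism ::
    "nat \<Rightarrow> 'a flag_graph \<Rightarrow> 'a set \<Rightarrow> ('a \<Rightarrow> 'a) \<Rightarrow> bool" where
  "extends_to_automorphism n K F \<sigma> \<longleftrightarrow> (\<exists>\<tau>\<in>automorphisms n K. \<forall>\<Phi>\<in>F. \<tau> \<Phi> = \<sigma> \<Phi>)"


section \<open>Groups given by generators and relators\<close>

text \<open>
  A word is a list of letters \<open>(x, b)\<close>, standing for the generator \<open>x\<close> if \<open>b\<close> is true and
  for its inverse otherwise. The relators are words that are set equal to the identity.
\<close>

inductive pres_eq :: "'g set \<Rightarrow> ('g \<times> bool) list set \<Rightarrow> ('g \<times> bool) list \<Rightarrow> ('g \<times> bool) list \<Rightarrow> bool"
  for X R where
  pres_refl: "u \<in> lists (X \<times> UNIV) \<Longrightarrow> pres_eq X R u u"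
| pres_sym: "pres_eq X R u v \<Longrightarrow> pres_eq X R v u"
| pres_trans: "pres_eq X R u v \<Longrightarrow> pres_eq X R v w \<Longrightarrow> pres_eq X R u w"
| pres_append: "pres_eq X R u v \<Longrightarrow> pres_eq X R u' v' \<Longrightarrow> pres_eq X R (u @ u') (v @ v')"
| pres_cancel: "x \<in> X \<Longrightarrow> pres_eq X R [(x, b), (x, \<not> b)] []"
| pres_relator: "r \<in> R \<Longrightarrow> r \<in> lists (X \<times> UNIV) \<Longrightarrow> pres_eq X R r []"

definition word_class :: "'g set \<Rightarrow> ('g \<times> bool) list set \<Rightarrow> ('g \<times> bool) list \<Rightarrow> ('g \<times> bool) list set" where
  "word_class X R u = {v. pres_eq X R u v}"

definition presented_group :: "'g set \<Rightarrow> ('g \<times> bool) list set \<Rightarrow> ('g \<times> bool) list set monoid" where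
  "presented_group X R =
    \<lparr>carrier = word_class X R ` lists (X \<times> UNIV),
     monoid.mult = (\<lambda>A B. \<Union>a\<in>A. \<Union>b\<in>B. word_class X R (a @ b)),
     one = word_class X R []\<rparr>"

lemma word_class_eqI:
  assumes "pres_eq X R u v"
  shows "word_class X R u = word_class X R v"
  unfolding word_class_def
proof (rule Collect_cong)
  fix w
  show "pres_eq X R u w = pres_eq X R v w"
    using assms pres_trans[of X R u v w] pres_trans[of X R v u w] pres_sym[of X R u v] by iprover
qed

lemma word_class_mult:
  assumes "u \<in> lists (X \<times> UNIV)" "v \<in> lists (X \<times> UNIV)"
  shows "word_class X R u \<otimes>\<^bsub>presented_group X R\<^esub> word_class X R v = word_class X R (u @ v)"
proof -
  have eq: "word_class X R (a @ b) = word_class X R (u @ v)"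
    if "a \<in> word_class X R u" "b \<in> word_class X R v" for a b
  proof -
    have "pres_eq X R u a" "pres_eq X R v b" using that unfolding word_class_def by blast+
    then show ?thesis by (rule word_class_eqI[OF pres_append, symmetric])
  qed
  have mem: "u \<in> word_class X R u" "v \<in> word_class X R v"
    unfolding word_class_def using pres_refl[OF assms(1)] pres_refl[OF assms(2)] by blast+
  have "(\<Union>a\<in>word_class X R u. \<Union>b\<in>word_class X R v. word_class X R (a @ b)) = word_class X R (u @ v)"
  proof (intro equalityI UN_least)
    show "word_class X R (a @ b) \<subseteq> word_class X R (u @ v)"
      if "a \<in> word_class X R u" "b \<in> word_class X R v" for a b
      using eq[OF that] by simp
    show "word_class X R (u @ v) \<subseteq>
        (\<Union>a\<in>word_class X R u. \<Union>b\<in>word_class X R v. word_class X R (a @ b))"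
      using mem by blast
  qed
  then show ?thesis unfolding presented_group_def by simp
qed

lemma pres_eq_inverse:
  assumes "u \<in> lists (X \<times> UNIV)"
  shows "pres_eq X R (rev (map (\<lambda>(x, b). (x, \<not> b)) u) @ u) []"
  using assms
proof (induction u)
  case Nil
  show ?case by (simp add: pres_refl)
next
  case (Cons l u)
  obtain x b where l: "l = (x, b)" by fastforce
  let ?i = "\<lambda>u. rev (map (\<lambda>(x, b). (x, \<not> b)) u)"
  have x: "x \<in> X" and u: "u \<in> lists (X \<times> UNIV)"
    using Cons.hyps l by auto
  have iu: "?i u \<in> lists (X \<times> UNIV)" using u by auto
  have "pres_eq X R [(x, \<not> b), (x, b)] []" using pres_cancel[OF x, of R "\<not> b"] by simp
  then have "pres_eq X R ([(x, \<not> b), (x, b)] @ u) ([] @ u)"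
    by (rule pres_append) (rule pres_refl[OF u])
  then have "pres_eq X R (?i u @ [(x, \<not> b), (x, b)] @ u) (?i u @ [] @ u)"
    by (rule pres_append[OF pres_refl[OF iu]])
  then have "pres_eq X R (?i u @ [(x, \<not> b), (x, b)] @ u) []"
    using Cons.IH by (simp add: pres_trans)
  then show ?case using l by simp
qed

lemma group_presented_group: "group (presented_group X R)" (is "group ?G")
proof -
  have car: "carrier ?G = word_class X R ` lists (X \<times> UNIV)" and
    one: "\<one>\<^bsub>?G\<^esub> = word_class X R []"
    by (simp_all add: presented_group_def)
  have app: "u @ v \<in> lists (X \<times> UNIV)" if "u \<in> lists (X \<times> UNIV)" "v \<in> lists (X \<times> UNIV)"
    for u v :: "('a \<times> bool) list" using that by auto
  show ?thesis
  proof (rule groupI)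
    fix A assume "A \<in> carrier ?G"
    then obtain u where u: "u \<in> lists (X \<times> UNIV)" "A = word_class X R u" using car by auto
    let ?v = "rev (map (\<lambda>(x, b). (x, \<not> b)) u)"
    have v: "?v \<in> lists (X \<times> UNIV)" using u by auto
    have "word_class X R ?v \<otimes>\<^bsub>?G\<^esub> A = \<one>\<^bsub>?G\<^esub>"
      unfolding u(2) one word_class_mult[OF v u(1)]
      by (rule word_class_eqI[OF pres_eq_inverse[OF u(1)]])
    then show "\<exists>B\<in>carrier ?G. B \<otimes>\<^bsub>?G\<^esub> A = \<one>\<^bsub>?G\<^esub>"
      using v car by blast
  next
    fix A B assume "A \<in> carrier ?G" "B \<in> carrier ?G"
    then obtain u v where uv: "u \<in> lists (X \<times> UNIV)" "v \<in> lists (X \<times> UNIV)"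
      and AB: "A = word_class X R u" "B = word_class X R v"
      unfolding car by blast
    show "A \<otimes>\<^bsub>?G\<^esub> B \<in> carrier ?G"
      unfolding AB word_class_mult[OF uv] car by (rule imageI[OF app[OF uv]])
  next
    fix A B C assume "A \<in> carrier ?G" "B \<in> carrier ?G" "C \<in> carrier ?G"
    then obtain u v w where uvw: "u \<in> lists (X \<times> UNIV)" "v \<in> lists (X \<times> UNIV)"
      "w \<in> lists (X \<times> UNIV)" and
      ABC: "A = word_class X R u" "B = word_class X R v" "C = word_class X R w"
      unfolding car by blast
    show "A \<otimes>\<^bsub>?G\<^esub> B \<otimes>\<^bsub>?G\<^esub> C = A \<otimes>\<^bsub>?G\<^esub> (B \<otimes>\<^bsub>?G\<^esub> C)"
      unfolding ABC by (simp only: word_class_mult app uvw append_assoc)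
  next
    show "\<one>\<^bsub>?G\<^esub> \<in> carrier ?G" unfolding car one by (rule imageI) simp
  next
    fix A assume "A \<in> carrier ?G"
    then obtain u where "u \<in> lists (X \<times> UNIV)" "A = word_class X R u" unfolding car by blast
    then show "\<one>\<^bsub>?G\<^esub> \<otimes>\<^bsub>?G\<^esub> A = A"
      unfolding one using word_class_mult[of "[]" X u R] by simp
  qed
qed


section \<open>Universal Cayley extensions\<close>

locale pre_extender =
  fixes n :: nat and K :: "'a flag_graph" and rn :: "'a \<Rightarrow> 'a"
  assumes bij: "bij_betw rn (flags K) (flags K)"
    and invol: "\<And>\<Phi>. \<Phi> \<in> flags K \<Longrightarrow> rn (rn \<Phi>) = \<Phi>"
    and commute: "\<And>i \<Phi>. i < n - 1 \<Longrightarrow> \<Phi> \<in> flags K \<Longrightarrow> rn (adj K i \<Phi>) = adj K i (rn \<Phi>)"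

definition extension_group ::
    "nat \<Rightarrow> 'a flag_graph \<Rightarrow> ('a \<Rightarrow> 'a) \<Rightarrow> ('a set \<times> bool) list set monoid" where
  "extension_group n K rn = presented_group (facets n K)
     {[(F, True), (rn ` F, True)] | F. F \<in> facets n K}"

definition facet_gen ::
    "nat \<Rightarrow> 'a flag_graph \<Rightarrow> ('a \<Rightarrow> 'a) \<Rightarrow> 'a set \<Rightarrow> ('a set \<times> bool) list set" where
  "facet_gen n K rn F = word_class (facets n K)
     {[(F, True), (rn ` F, True)] | F. F \<in> facets n K} [(F, True)]"

text \<open>A graph of rank \<open>n + 1\<close>: only the colours \<open>i \<le> n\<close> are relevant.\<close>

definition universal_cayley_extension ::
    "nat \<Rightarrow> 'a flag_graph \<Rightarrow> ('a \<Rightarrow> 'a) \<Rightarrow> ('a \<times> ('a set \<times> bool) list set) flag_graph" where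
  "universal_cayley_extension n K rn =
    \<lparr>flags = flags K \<times> carrier (extension_group n K rn),
     adj = (\<lambda>i (\<Phi>, \<gamma>). if i < n then (adj K i \<Phi>, \<gamma>)
       else (rn \<Phi>, facet_gen n K rn (facet_of n K \<Phi>) \<otimes>\<^bsub>extension_group n K rn\<^esub> \<gamma>))\<rparr>"

definition friendly :: "nat \<Rightarrow> 'a flag_graph \<Rightarrow> ('a \<Rightarrow> 'a) \<Rightarrow> ('a \<Rightarrow> 'a) set \<Rightarrow> bool" where
  "friendly n K rn S \<longleftrightarrow> S \<subseteq> automorphisms n K \<and>
     (\<forall>\<Phi>\<in>flags K. \<forall>\<tau>\<in>S. \<exists>\<tau>'\<in>S. rn (\<tau> \<Phi>) = \<tau>' (rn \<Phi>))"

definition universal_extensions_isomorphic :: "nat \<Rightarrow> 'a flag_graph \<Rightarrow> bool" where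
  "universal_extensions_isomorphic n K \<longleftrightarrow>
     (\<forall>rn rn'. pre_extender n K rn \<longrightarrow> pre_extender n K rn' \<longrightarrow>
        isomorphic (n + 1) (universal_cayley_extension n K rn) (universal_cayley_extension n K rn'))"

definition facet_isos_extend :: "nat \<Rightarrow> 'a flag_graph \<Rightarrow> bool" where
  "facet_isos_extend n K \<longleftrightarrow>
     (\<forall>F\<in>facets n K. \<forall>F'\<in>facets n K. F \<noteq> F' \<longrightarrow>
        (\<forall>\<sigma>\<in>facet_isos n K F F'. extends_to_automorphism n K F \<sigma>)) \<and>
     (\<forall>F\<in>facets n K. \<forall>\<sigma>\<in>facet_isos n K F F. (\<forall>\<Phi>\<in>F. \<sigma> (\<sigma> \<Phi>) = \<Phi>) \<longrightarrow>
        extends_to_automorphism n K F \<sigma>)"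


subsection \<open>The extension is a premaniplex\<close>

lemma component_step:
  assumes "premaniplex n K" "m \<le> n" "i < m" "\<Phi> \<in> flags K"
  shows "component m K (adj K i \<Phi>) = component m K \<Phi>"
proof -
  interpret premaniplex n K by fact
  define S where "S = (\<lambda>x y. \<exists>i<m. y = adj K i x)"
  have "adj K i (adj K i \<Phi>) = \<Phi>" using assms adj_invol by simp
  then have "S (adj K i \<Phi>) \<Phi>" unfolding S_def using assms(3) by metis
  moreover have "S \<Phi> (adj K i \<Phi>)" unfolding S_def using assms(3) by blast
  ultimately have "S\<^sup>*\<^sup>* \<Phi> \<Psi> \<longleftrightarrow> S\<^sup>*\<^sup>* (adj K i \<Phi>) \<Psi>" for \<Psi>
    using converse_rtranclp_into_rtranclp[of S \<Phi> "adj K i \<Phi>" \<Psi>]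
      converse_rtranclp_into_rtranclp[of S "adj K i \<Phi>" \<Phi> \<Psi>] by iprover
  then have "Collect (S\<^sup>*\<^sup>* (adj K i \<Phi>)) = Collect (S\<^sup>*\<^sup>* \<Phi>)"
    by (intro arg_cong[of _ _ Collect] ext) simp
  then show ?thesis unfolding component_def S_def .
qed

lemma (in premaniplex) component_subset:
  assumes "m \<le> n" "\<Phi> \<in> flags K"
  shows "component m K \<Phi> \<subseteq> flags K"
proof
  fix \<Psi> assume "\<Psi> \<in> component m K \<Phi>"
  then have "(\<lambda>x y. \<exists>i<m. y = adj K i x)\<^sup>*\<^sup>* \<Phi> \<Psi>" by (simp add: component_def)
  then show "\<Psi> \<in> flags K"
    by (induction rule: rtranclp_induct) (use assms adj_closed in auto)
qed

lemma pre_extender_image_component: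
  assumes "premaniplex n K" "pre_extender n K rn" "\<Phi> \<in> flags K"
  shows "rn ` facet_of n K \<Phi> = facet_of n K (rn \<Phi>)"
proof -
  interpret premaniplex n K by fact
  interpret pre_extender n K rn by fact
  have sub: "rn ` facet_of n K \<Psi> \<subseteq> facet_of n K (rn \<Psi>)" if "\<Psi> \<in> flags K" for \<Psi>
  proof -
    have "(\<lambda>x y. \<exists>i<n - 1. y = adj K i x)\<^sup>*\<^sup>* (rn \<Psi>) (rn \<Theta>) \<and> \<Theta> \<in> flags K"
      if "(\<lambda>x y. \<exists>i<n - 1. y = adj K i x)\<^sup>*\<^sup>* \<Psi> \<Theta>" for \<Theta>
      using that
    proof (induction rule: rtranclp_induct)
      case base
      then show ?case using \<open>\<Psi> \<in> flags K\<close> by simp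
    next
      case (step y z)
      then obtain i where i: "i < n - 1" "z = adj K i y" by auto
      then have "i < n" "y \<in> flags K" using step.IH by auto
      then have z: "rn z = adj K i (rn y)" "z \<in> flags K" using i commute adj_closed by auto
      show ?case
      proof
        show "(\<lambda>x y. \<exists>i<n - 1. y = adj K i x)\<^sup>*\<^sup>* (rn \<Psi>) (rn z)"
          using step.IH[THEN conjunct1]
          by (rule rtranclp.rtrancl_into_rtrancl) (use i z in blast)
      qed (fact z)
    qed
    then show ?thesis unfolding facet_of_def component_def by blast
  qed
  have "rn \<Phi> \<in> flags K" using bij assms(3) by (auto simp: bij_betw_def)
  then have "rn ` facet_of n K (rn \<Phi>) \<subseteq> facet_of n K \<Phi>"
    using sub[of "rn \<Phi>"] invol[OF assms(3)] by simp
  moreover have "rn (rn \<Psi>) = \<Psi>" if "\<Psi> \<in> facet_of n K (rn \<Phi>)" for \<Psi>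
    using that component_subset[of "n - 1" "rn \<Phi>"] \<open>rn \<Phi> \<in> flags K\<close> invol
    by (simp add: facet_of_def subset_iff)
  ultimately have "facet_of n K (rn \<Phi>) \<subseteq> rn ` facet_of n K \<Phi>"
    by (metis image_eqI image_subset_iff subsetI)
  then show ?thesis using sub[OF assms(3)] by (rule equalityI[rotated])
qed

lemma premaniplex_universal_cayley_extension:
  assumes "premaniplex n K" "pre_extender n K rn"
  shows "premaniplex (n + 1) (universal_cayley_extension n K rn)"
proof -
  interpret K: premaniplex n K by fact
  interpret E: pre_extender n K rn by fact
  let ?R = "{[(F, True), (rn ` F, True)] | F. F \<in> facets n K}"
  let ?G = "extension_group n K rn"
  let ?U = "universal_cayley_extension n K rn"
  let ?a = "\<lambda>\<Phi>. facet_gen n K rn (facet_of n K \<Phi>)"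
  interpret G: group ?G unfolding extension_group_def by (rule group_presented_group)
  have rn: "rn \<Phi> \<in> flags K" if "\<Phi> \<in> flags K" for \<Phi>
    using that E.bij by (auto simp: bij_betw_def)
  have fac: "facet_of n K \<Phi> \<in> facets n K" if "\<Phi> \<in> flags K" for \<Phi>
    using that by (simp add: facets_def)
  have gen: "?a \<Phi> \<in> carrier ?G" if "\<Phi> \<in> flags K" for \<Phi>
    using fac[OF that] by (auto simp: facet_gen_def extension_group_def presented_group_def)
  have inv: "?a (rn \<Phi>) \<otimes>\<^bsub>?G\<^esub> ?a \<Phi> = \<one>\<^bsub>?G\<^esub>" if \<Phi>: "\<Phi> \<in> flags K" for \<Phi>
  proof -
    let ?F = "facet_of n K (rn \<Phi>)"
    have im: "rn ` ?F = facet_of n K \<Phi>"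
      using pre_extender_image_component[OF assms rn[OF \<Phi>]] E.invol[OF \<Phi>] by simp
    have "[(?F, True), (facet_of n K \<Phi>, True)] \<in> ?R" using im fac[OF rn[OF \<Phi>]] by blast
    then have "pres_eq (facets n K) ?R [(?F, True), (facet_of n K \<Phi>, True)] []"
      by (rule pres_relator) (use fac[OF \<Phi>] fac[OF rn[OF \<Phi>]] in auto)
    then have "word_class (facets n K) ?R ([(?F, True)] @ [(facet_of n K \<Phi>, True)]) =
        word_class (facets n K) ?R []"
      by (simp add: word_class_eqI)
    then show ?thesis
      unfolding facet_gen_def extension_group_def
      by (subst word_class_mult) (use fac[OF \<Phi>] fac[OF rn[OF \<Phi>]] in \<open>auto simp: presented_group_def\<close>)
  qed
  have inv': "?a (rn \<Phi>) \<otimes>\<^bsub>?G\<^esub> (?a \<Phi> \<otimes>\<^bsub>?G\<^esub> \<gamma>) = \<gamma>"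
    if "\<Phi> \<in> flags K" "\<gamma> \<in> carrier ?G" for \<Phi> \<gamma>
    using inv[OF that(1)] gen[OF that(1)] gen[OF rn[OF that(1)]] that(2)
    by (simp add: G.m_assoc[symmetric])
  have step: "?a (adj K i \<Phi>) = ?a \<Phi>" if "i < n - 1" "\<Phi> \<in> flags K" for i \<Phi>
    using component_step[OF assms(1) _ that] by (simp add: facet_of_def)
  show ?thesis
  proof
    fix i \<Phi> assume *: "i < n + 1" "\<Phi> \<in> flags ?U"
    show "adj ?U i \<Phi> \<in> flags ?U" "adj ?U i (adj ?U i \<Phi>) = \<Phi>"
      using * K.adj_closed K.adj_invol rn gen inv' E.invol
      by (auto simp: universal_cayley_extension_def)
  next
    fix i j \<Phi> assume *: "i < n + 1" "j < n + 1" "\<bar>int i - int j\<bar> > 1" "\<Phi> \<in> flags ?U"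
    consider "i < n" "j < n" | "i = n" "j < n - 1" | "i < n - 1" "j = n" using * by linarith
    then show "adj ?U i (adj ?U j (adj ?U i (adj ?U j \<Phi>))) = \<Phi>"
    proof cases
      case 1
      then show ?thesis using * K.adj_square by (auto simp: universal_cayley_extension_def)
    next
      case 2
      then have "j < n" by simp
      with 2 show ?thesis using * K.adj_closed K.adj_invol rn gen inv' E.invol E.commute step
        by (auto simp: universal_cayley_extension_def)
    next
      case 3
      then have "i < n" by simp
      with 3 show ?thesis using * K.adj_closed K.adj_invol rn gen inv' E.invol E.commute step
        by (auto simp: universal_cayley_extension_def)
    qed
  qed
qed

end

theory Submission
  imports Defs
begin

text \<open>
  If facet isomorphisms extend, then a pre-extender \<open>rn\<close> agrees on each facet with an automorphism
  of \<open>K\<close>, which is unique by connectedness. For pre-extenders \<open>rn\<close>, \<open>rn'\<close>, an automorphism \<open>\<tau>\<close>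
  and a facet \<open>F\<close> there is therefore exactly one automorphism \<open>\<tau>'\<close> with
  \<open>\<tau>' (rn \<Phi>) = rn' (\<tau> \<Phi>)\<close> on \<open>F\<close>; friendliness is the case \<open>rn' = rn\<close>. Letting \<open>\<alpha>\<^sub>F\<close> send
  \<open>(\<tau>, g)\<close> to \<open>(\<tau>', \<alpha>'\<^bsub>\<tau> F\<^esub> g)\<close> respects the relators of the extension group, and the orbit of
  \<open>(id, 1)\<close> yields a colour-preserving map between the two extensions that is the identity on the
  base copy of \<open>K\<close>. The map in the opposite direction is its inverse, because a colour-preserving
  self-map of a connected graph that fixes a flag is the identity.

  Conversely, let \<open>rn\<close> act as \<open>\<sigma>\<close> on \<open>F\<close>, as its inverse on \<open>F'\<close> and trivially elsewhere, and
  project an isomorphism onto the extension for the identity pre-extender to \<open>K\<close>. It restricts to an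
  automorphism of \<open>K\<close> on each copy of \<open>K\<close> and does not change along edges of colour \<open>n\<close>, so \<open>\<sigma>\<close>
  is a quotient of two such automorphisms.
\<close>

section \<open>Isomorphisms and facets\<close>

lemma isosD:
  assumes "\<sigma> \<in> isos n K L"
  shows isos_extensional: "\<sigma> \<in> extensional (flags K)"
    and isos_bij: "bij_betw \<sigma> (flags K) (flags L)"
    and isos_closed: "\<And>\<Phi>. \<Phi> \<in> flags K \<Longrightarrow> \<sigma> \<Phi> \<in> flags L"
    and isos_adj: "\<And>i \<Phi>. i < n \<Longrightarrow> \<Phi> \<in> flags K \<Longrightarrow> \<sigma> (adj K i \<Phi>) = adj L i (\<sigma> \<Phi>)"
  using assms by (auto simp: isos_def bij_betw_def)

lemma isos_compose:
  assumes K: "premaniplex n K" and \<sigma>: "\<sigma> \<in> isos n K L" and \<tau>: "\<tau> \<in> isos n L M"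
  shows "compose (flags K) \<tau> \<sigma> \<in> isos n K M"
proof -
  interpret premaniplex n K by fact
  have "bij_betw (compose (flags K) \<tau> \<sigma>) (flags K) (flags M)"
    using isos_bij[OF \<sigma>] isos_bij[OF \<tau>] by (rule bij_betw_compose)
  then show ?thesis
    using isosD[OF \<sigma>] isosD[OF \<tau>] adj_closed
    by (auto simp: isos_def compose_def)
qed

lemma isos_inverse:
  assumes K: "premaniplex n K" and L: "premaniplex n L" and \<sigma>: "\<sigma> \<in> isos n K L"
  shows "restrict (inv_into (flags K) \<sigma>) (flags L) \<in> isos n L K"
proof -
  interpret K: premaniplex n K by fact
  interpret L: premaniplex n L by fact
  let ?i = "inv_into (flags K) \<sigma>"
  have bij: "bij_betw \<sigma> (flags K) (flags L)" by (rule isos_bij[OF \<sigma>])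
  have "?i (adj L i \<Phi>) = adj K i (?i \<Phi>)" if i: "i < n" and \<Phi>: "\<Phi> \<in> flags L" for i \<Phi>
  proof -
    have m: "?i \<Phi> \<in> flags K" and e: "\<sigma> (?i \<Phi>) = \<Phi>"
      using bij \<Phi> by (auto simp: bij_betw_def inv_into_into f_inv_into_f)
    have "?i (\<sigma> (adj K i (?i \<Phi>))) = adj K i (?i \<Phi>)"
      using bij K.adj_closed[OF i m] by (simp add: bij_betw_def inv_into_f_f)
    then show ?thesis using isos_adj[OF \<sigma> i m] e by simp
  qed
  then show ?thesis
    using bij_betw_inv_into[OF bij] L.adj_closed by (auto simp: isos_def cong: bij_betw_cong)
qed

section \<open>Components and facets\<close>

lemma component_refl: "\<Phi> \<in> component m K \<Phi>"
  by (simp add: component_def)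

lemma adj_in_component: "\<Psi> \<in> component m K \<Phi> \<Longrightarrow> i < m \<Longrightarrow> adj K i \<Psi> \<in> component m K \<Phi>"
  unfolding component_def by (auto intro: rtranclp.rtrancl_into_rtrancl)

text \<open>The step case also supplies membership in the component. From it follows membership in
  \<open>flags K\<close>, where alone \<open>adj\<close> is controlled.\<close>

lemma component_induct [consumes 1, case_names base step]:
  assumes "\<Theta> \<in> component m K \<Phi>" and "P \<Phi>"
    and "\<And>i \<Psi>. i < m \<Longrightarrow> \<Psi> \<in> component m K \<Phi> \<Longrightarrow> P \<Psi> \<Longrightarrow> P (adj K i \<Psi>)"
  shows "P \<Theta>"
proof -
  have "(\<lambda>x y. \<exists>i<m. y = adj K i x)\<^sup>*\<^sup>* \<Phi> \<Theta>" using assms(1) by (simp add: component_def)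
  then show ?thesis
    by (induction rule: rtranclp_induct) (use assms in \<open>auto simp: component_def\<close>)
qed

context premaniplex
begin

lemma component_eq:
  assumes "m \<le> n" "\<Phi> \<in> flags K" "\<Psi> \<in> component m K \<Phi>"
  shows "component m K \<Psi> = component m K \<Phi>"
  using assms(3)
proof (induction rule: component_induct)
  case (step i \<Psi>)
  then have "\<Psi> \<in> flags K" using component_subset[OF assms(1,2)] by blast
  then show ?case using component_step[OF premaniplex_axioms assms(1)] step by simp
qed simp

lemma facet_of_mem: "\<Phi> \<in> flags K \<Longrightarrow> facet_of n K \<Phi> \<in> facets n K"
  by (simp add: facets_def)

lemma mem_facet_of: "\<Phi> \<in> facet_of n K \<Phi>"
  by (simp add: facet_of_def component_refl)

lemma facetD:
  assumes "F \<in> facets n K"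
  shows facet_subset: "F \<subseteq> flags K"
    and facet_of_eq: "\<And>\<Phi>. \<Phi> \<in> F \<Longrightarrow> facet_of n K \<Phi> = F"
    and facet_nonempty: "F \<noteq> {}"
    and facet_adj: "\<And>i \<Phi>. i < n - 1 \<Longrightarrow> \<Phi> \<in> F \<Longrightarrow> adj K i \<Phi> \<in> F"
proof -
  obtain \<Phi> where \<Phi>: "\<Phi> \<in> flags K" and F: "F = component (n - 1) K \<Phi>"
    using assms by (auto simp: facets_def facet_of_def)
  show "F \<subseteq> flags K" unfolding F by (rule component_subset) (use \<Phi> in simp_all)
  show "facet_of n K \<Psi> = F" if "\<Psi> \<in> F" for \<Psi>
    using component_eq[of "n - 1"] \<Phi> that unfolding F facet_of_def by simp
  show "F \<noteq> {}" unfolding F using component_refl by (metis empty_iff)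
  show "adj K i \<Psi> \<in> F" if "i < n - 1" "\<Psi> \<in> F" for i \<Psi>
    using that adj_in_component unfolding F by metis
qed

lemma facets_disjoint:
  "F \<in> facets n K \<Longrightarrow> F' \<in> facets n K \<Longrightarrow> \<Phi> \<in> F \<Longrightarrow> \<Phi> \<in> F' \<Longrightarrow> F = F'"
  using facet_of_eq by metis

text \<open>Applying the involution twice reverses the step. The equivalence is what lets maps
  defined by cases on membership in a facet commute with \<open>adj\<close>.\<close>

lemma facet_adj_iff:
  assumes F: "F \<in> facets n K" and i: "i < n - 1" and \<Phi>: "\<Phi> \<in> flags K"
  shows "adj K i \<Phi> \<in> F \<longleftrightarrow> \<Phi> \<in> F"
proof -
  have "adj K i (adj K i \<Phi>) = \<Phi>" using adj_invol[OF _ \<Phi>, of i] i by simp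
  then show ?thesis using facet_adj[OF F i, of \<Phi>] facet_adj[OF F i, of "adj K i \<Phi>"] by auto
qed

text \<open>Paths are mapped forward by \<open>\<tau>\<close>; conversely, a path starting at
  \<open>\<tau> \<Phi>\<close> lifts edge by edge to a path starting at
  \<open>\<Phi>\<close>.\<close>

lemma automorphism_image_facet_of:
  assumes \<tau>: "\<tau> \<in> automorphisms n K" and \<Phi>: "\<Phi> \<in> flags K"
  shows "\<tau> ` facet_of n K \<Phi> = facet_of n K (\<tau> \<Phi>)"
proof -
  have sub: "component (n - 1) K \<Phi> \<subseteq> flags K" using component_subset \<Phi> by simp
  have adj: "\<tau> (adj K i \<Psi>) = adj K i (\<tau> \<Psi>)" if "i < n - 1" "\<Psi> \<in> component (n - 1) K \<Phi>" for i \<Psi>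
    using isos_adj[OF \<tau>] sub that by auto
  have "\<tau> \<Theta> \<in> component (n - 1) K (\<tau> \<Phi>)" if "\<Theta> \<in> component (n - 1) K \<Phi>" for \<Theta>
    using that by (induction rule: component_induct) (auto simp: component_refl adj adj_in_component)
  moreover have "\<Theta> \<in> \<tau> ` component (n - 1) K \<Phi>" if "\<Theta> \<in> component (n - 1) K (\<tau> \<Phi>)" for \<Theta>
    using that
  proof (induction rule: component_induct)
    case base
    show ?case by (simp add: component_refl)
  next
    case (step i \<Psi>)
    then obtain \<Theta> where \<Theta>: "\<Theta> \<in> component (n - 1) K \<Phi>" "\<Psi> = \<tau> \<Theta>" by blast
    then have "adj K i \<Psi> = \<tau> (adj K i \<Theta>)" using adj step(1) by simp
    then show ?case using adj_in_component[OF \<Theta>(1) step(1)] by blast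
  qed
  ultimately show ?thesis unfolding facet_of_def by blast
qed

lemma automorphism_image_facet:
  assumes \<tau>: "\<tau> \<in> automorphisms n K" and F: "F \<in> facets n K"
  shows "\<tau> ` F \<in> facets n K"
proof -
  obtain \<Phi> where "\<Phi> \<in> flags K" "F = facet_of n K \<Phi>" using F by (auto simp: facets_def)
  then show ?thesis
    using automorphism_image_facet_of[OF \<tau>] isos_closed[OF \<tau>] facet_of_mem by simp
qed

section \<open>Pre-extenders acting on facets\<close>

lemma pre_extender_closed: "pre_extender n K rn \<Longrightarrow> \<Phi> \<in> flags K \<Longrightarrow> rn \<Phi> \<in> flags K"
  by (auto simp: pre_extender_def bij_betw_def)

lemma pre_extender_image_facet:
  assumes rn: "pre_extender n K rn" and F: "F \<in> facets n K"
  shows "rn ` F \<in> facets n K"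
proof -
  obtain \<Phi> where "\<Phi> \<in> flags K" "F = facet_of n K \<Phi>" using F by (auto simp: facets_def)
  then show ?thesis
    using pre_extender_image_component[OF premaniplex_axioms rn] pre_extender_closed[OF rn]
      facet_of_mem by simp
qed

lemma pre_extender_image_image:
  assumes rn: "pre_extender n K rn" and F: "F \<subseteq> flags K"
  shows "rn ` rn ` F = F"
  using pre_extender.invol[OF rn] F by (force simp: image_image)

lemma pre_extender_facet_iso:
  assumes rn: "pre_extender n K rn" and F: "F \<in> facets n K"
  shows "restrict rn F \<in> facet_isos n K F (rn ` F)"
proof -
  have "inj_on rn F"
    using pre_extender.bij[OF rn] facet_subset[OF F] by (auto simp: bij_betw_def intro: inj_on_subset)
  then show ?thesis
    using pre_extender.commute[OF rn] facet_adj[OF F] facet_subset[OF F]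
    by (auto simp: facet_isos_def isos_def bij_betw_def)
qed

text \<open>The two clauses of \<open>facet_isos_extend\<close> match the two possibilities: either
  \<open>rn\<close> moves \<open>F\<close> to a different facet, or it preserves \<open>F\<close>
  and restricts to an involution there.\<close>

lemma pre_extender_extends:
  assumes ext: "facet_isos_extend n K" and rn: "pre_extender n K rn" and F: "F \<in> facets n K"
  obtains \<rho> where "\<rho> \<in> automorphisms n K" "\<And>\<Phi>. \<Phi> \<in> F \<Longrightarrow> \<rho> \<Phi> = rn \<Phi>"
proof -
  note iso = pre_extender_facet_iso[OF rn F]
  have "extends_to_automorphism n K F (restrict rn F)"
  proof (cases "rn ` F = F")
    case True
    then have "restrict rn F (restrict rn F \<Phi>) = \<Phi>" if "\<Phi> \<in> F" for \<Phi>
      using pre_extender.invol[OF rn] facet_subset[OF F] that by auto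
    then show ?thesis using ext iso F True unfolding facet_isos_extend_def by metis
  next
    case False
    then show ?thesis
      using ext iso F pre_extender_image_facet[OF rn F] unfolding facet_isos_extend_def by metis
  qed
  then show ?thesis using that unfolding extends_to_automorphism_def by auto
qed

text \<open>On the image of \<open>F\<close> under \<open>rn\<close>, the required map is
  \<open>rn\<close>, then \<open>\<tau>\<close>, then \<open>rn'\<close>. Both pre-extenders can be
  replaced by automorphisms agreeing with them on the facets involved.\<close>

lemma conjugate_automorphism_ex:
  assumes ext: "facet_isos_extend n K"
    and rn: "pre_extender n K rn" and rn': "pre_extender n K rn'"
    and \<tau>: "\<tau> \<in> automorphisms n K" and F: "F \<in> facets n K"
  shows "\<exists>\<tau>'\<in>automorphisms n K. \<forall>\<Phi>\<in>F. \<tau>' (rn \<Phi>) = rn' (\<tau> \<Phi>)"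
proof -
  \<comment> \<open>Chosen on the image of \<open>F\<close>, where \<open>rn\<close> leads back to
    \<open>F\<close>, so that composing with \<open>\<rho>\<close> undoes \<open>rn\<close> without
    inverting an automorphism.\<close>
  obtain \<rho> where \<rho>: "\<rho> \<in> automorphisms n K" "\<And>\<Phi>. \<Phi> \<in> rn ` F \<Longrightarrow> \<rho> \<Phi> = rn \<Phi>"
    using pre_extender_extends[OF ext rn pre_extender_image_facet[OF rn F]] by blast
  obtain \<rho>' where \<rho>': "\<rho>' \<in> automorphisms n K" "\<And>\<Phi>. \<Phi> \<in> \<tau> ` F \<Longrightarrow> \<rho>' \<Phi> = rn' \<Phi>"
    using pre_extender_extends[OF ext rn' automorphism_image_facet[OF \<tau> F]] by blast
  let ?\<tau> = "compose (flags K) \<rho>' (compose (flags K) \<tau> \<rho>)"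
  have "?\<tau> \<in> automorphisms n K"
    using \<rho>(1) \<tau> \<rho>'(1) by (intro isos_compose premaniplex_axioms)
  moreover have "?\<tau> (rn \<Phi>) = rn' (\<tau> \<Phi>)" if "\<Phi> \<in> F" for \<Phi>
    using that \<rho>(2)[of "rn \<Phi>"] \<rho>'(2) facet_subset[OF F] pre_extender.invol[OF rn]
      pre_extender_closed[OF rn] by (auto simp: compose_def subset_iff)
  ultimately show ?thesis by blast
qed

section \<open>Constructing pre-extenders\<close>

lemma pre_extender_id: "pre_extender n K (\<lambda>\<Phi>. \<Phi>)"
  by unfold_locales (simp_all add: bij_betw_def)

lemma pre_extenderI:
  assumes "\<And>\<Phi>. \<Phi> \<in> flags K \<Longrightarrow> rn \<Phi> \<in> flags K \<and> rn (rn \<Phi>) = \<Phi>"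
    and "\<And>i \<Phi>. i < n - 1 \<Longrightarrow> \<Phi> \<in> flags K \<Longrightarrow> rn (adj K i \<Phi>) = adj K i (rn \<Phi>)"
  shows "pre_extender n K rn"
  using assms by unfold_locales (auto intro!: bij_betw_byWitness[where f' = rn])

text \<open>Distinct facets are disjoint, so the cases do not conflict and the second one undoes the
  first. Colours below \<open>n - 1\<close> never leave a case.\<close>

lemma pre_extender_of_swap:
  assumes F: "F \<in> facets n K" and F': "F' \<in> facets n K" and ne: "F \<noteq> F'"
    and \<sigma>: "\<sigma> \<in> facet_isos n K F F'"
  shows "pre_extender n K
    (\<lambda>\<Phi>. if \<Phi> \<in> F then \<sigma> \<Phi> else if \<Phi> \<in> F' then inv_into F \<sigma> \<Phi> else \<Phi>)"
proof (rule pre_extenderI)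
  have bij: "bij_betw \<sigma> F F'" and adj: "\<And>i \<Phi>. i < n - 1 \<Longrightarrow> \<Phi> \<in> F \<Longrightarrow> \<sigma> (adj K i \<Phi>) = adj K i (\<sigma> \<Phi>)"
    using \<sigma> by (auto simp: facet_isos_def isos_def)
  have inv: "inv_into F \<sigma> \<Phi> \<in> F \<and> \<sigma> (inv_into F \<sigma> \<Phi>) = \<Phi>" if "\<Phi> \<in> F'" for \<Phi>
    using bij that by (auto simp: bij_betw_def inv_into_into f_inv_into_f)
  have fwd: "\<sigma> \<Phi> \<in> F' \<and> inv_into F \<sigma> (\<sigma> \<Phi>) = \<Phi>" if "\<Phi> \<in> F" for \<Phi>
    using bij that by (auto simp: bij_betw_def inv_into_f_f)
  have inv_adj: "inv_into F \<sigma> (adj K i \<Phi>) = adj K i (inv_into F \<sigma> \<Phi>)" if "i < n - 1" "\<Phi> \<in> F'" for i \<Phi>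
    using fwd[of "adj K i (inv_into F \<sigma> \<Phi>)"] inv[OF that(2)] adj[OF that(1)] facet_adj[OF F that(1)]
    by metis
  have disj: "\<Phi> \<notin> F" if "\<Phi> \<in> F'" for \<Phi> using facets_disjoint[OF F F'] ne that by blast
  let ?rn = "\<lambda>\<Phi>. if \<Phi> \<in> F then \<sigma> \<Phi> else if \<Phi> \<in> F' then inv_into F \<sigma> \<Phi> else \<Phi>"
  show "?rn \<Phi> \<in> flags K \<and> ?rn (?rn \<Phi>) = \<Phi>" if "\<Phi> \<in> flags K" for \<Phi>
    using that fwd inv disj facet_subset[OF F] facet_subset[OF F'] by auto
  show "?rn (adj K i \<Phi>) = adj K i (?rn \<Phi>)" if "i < n - 1" "\<Phi> \<in> flags K" for i \<Phi>
    using facet_adj_iff[OF F that] facet_adj_iff[OF F' that] adj[OF that(1)] inv_adj[OF that(1)]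
    by simp
qed

lemma pre_extender_of_involution:
  assumes F: "F \<in> facets n K" and \<sigma>: "\<sigma> \<in> facet_isos n K F F"
    and inv: "\<And>\<Phi>. \<Phi> \<in> F \<Longrightarrow> \<sigma> (\<sigma> \<Phi>) = \<Phi>"
  shows "pre_extender n K (\<lambda>\<Phi>. if \<Phi> \<in> F then \<sigma> \<Phi> else \<Phi>)"
proof (rule pre_extenderI)
  have bij: "bij_betw \<sigma> F F" and adj: "\<And>i \<Phi>. i < n - 1 \<Longrightarrow> \<Phi> \<in> F \<Longrightarrow> \<sigma> (adj K i \<Phi>) = adj K i (\<sigma> \<Phi>)"
    using \<sigma> by (auto simp: facet_isos_def isos_def)
  let ?rn = "\<lambda>\<Phi>. if \<Phi> \<in> F then \<sigma> \<Phi> else \<Phi>"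
  show "?rn \<Phi> \<in> flags K \<and> ?rn (?rn \<Phi>) = \<Phi>" if "\<Phi> \<in> flags K" for \<Phi>
    using that inv bij facet_subset[OF F] by (auto simp: bij_betw_def)
  show "?rn (adj K i \<Phi>) = adj K i (?rn \<Phi>)" if "i < n - 1" "\<Phi> \<in> flags K" for i \<Phi>
    using facet_adj_iff[OF F that] adj[OF that(1)] by simp
qed

end

section \<open>Consequences of connectedness\<close>

context maniplex
begin

lemma flag_induct [consumes 2, case_names base step]:
  assumes "\<Phi> \<in> flags K" "\<Theta> \<in> flags K" "P \<Phi>"
    and "\<And>i \<Psi>. i < n \<Longrightarrow> \<Psi> \<in> flags K \<Longrightarrow> P \<Psi> \<Longrightarrow> P (adj K i \<Psi>)"
  shows "P \<Theta>"
  using connected[OF assms(1,2)]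
  by (induction rule: component_induct) (use assms component_subset[of n \<Phi>] in auto)

text \<open>Agreement at one flag spreads along edges to every flag.\<close>

lemma automorphism_unique:
  assumes "\<tau> \<in> automorphisms n K" "\<tau>' \<in> automorphisms n K" "\<Phi> \<in> flags K" "\<tau> \<Phi> = \<tau>' \<Phi>"
  shows "\<tau> = \<tau>'"
proof (rule extensionalityI)
  show "\<tau> \<Theta> = \<tau>' \<Theta>" if "\<Theta> \<in> flags K" for \<Theta>
    using assms(3) that by (induction rule: flag_induct) (simp_all add: assms(4) isos_adj[OF assms(1)] isos_adj[OF assms(2)])
qed (use assms isos_extensional in auto)

text \<open>Surjectivity comes from connectedness: the image is nonempty and closed under all
  \<open>adj K i\<close> with \<open>i < n\<close>.\<close>

lemma automorphismI:
  assumes ext: "\<tau> \<in> extensional (flags K)" and closed: "\<And>\<Phi>. \<Phi> \<in> flags K \<Longrightarrow> \<tau> \<Phi> \<in> flags K"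
    and inj: "inj_on \<tau> (flags K)"
    and adj: "\<And>i \<Phi>. i < n \<Longrightarrow> \<Phi> \<in> flags K \<Longrightarrow> \<tau> (adj K i \<Phi>) = adj K i (\<tau> \<Phi>)"
  shows "\<tau> \<in> automorphisms n K"
proof -
  obtain \<Phi> where \<Phi>: "\<Phi> \<in> flags K" using nonempty by blast
  have "\<Theta> \<in> \<tau> ` flags K" if "\<Theta> \<in> flags K" for \<Theta>
    using closed[OF \<Phi>] that
  proof (induction rule: flag_induct)
    case (step i \<Psi>)
    then obtain \<Theta> where \<Theta>: "\<Theta> \<in> flags K" "\<Psi> = \<tau> \<Theta>" by blast
    then have "adj K i \<Psi> = \<tau> (adj K i \<Theta>)" using adj step(1) by simp
    then show ?case using adj_closed[OF step(1) \<Theta>(1)] by blast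
  qed (use \<Phi> in simp)
  then show ?thesis using ext inj adj closed by (auto simp: isos_def bij_betw_def)
qed

end


section \<open>The extension group\<close>

text \<open>This is the von Dyck principle: if letters act on \<open>W\<close> so that inverse
  letters cancel and relators act trivially, equivalent words act equally. Membership in
  \<open>W\<close> is part of the conclusion because a concatenation applies the second
  hypothesis-driven action to an intermediate value.\<close>

lemma pres_eq_foldr:
  fixes A :: "'g \<times> bool \<Rightarrow> 's \<Rightarrow> 's"
  assumes eq: "pres_eq X R u v"
    and closed: "\<And>x b s. x \<in> X \<Longrightarrow> s \<in> W \<Longrightarrow> A (x, b) s \<in> W"
    and cancel: "\<And>x b s. x \<in> X \<Longrightarrow> s \<in> W \<Longrightarrow> A (x, b) (A (x, \<not> b) s) = s"
    and relator: "\<And>r s. r \<in> R \<Longrightarrow> r \<in> lists (X \<times> UNIV) \<Longrightarrow> s \<in> W \<Longrightarrow> foldr A r s = s"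
    and s: "s \<in> W"
  shows "foldr A u s = foldr A v s \<and> foldr A u s \<in> W"
  using eq s
proof (induction arbitrary: s)
  case (pres_refl u)
  then show ?case by (induction u) (auto simp: closed)
next
  case (pres_append u v u' v')
  then show ?case by (metis foldr_append comp_apply)
next
  case (pres_sym u v)
  then show ?case by metis
next
  case (pres_trans u v w)
  then show ?case by metis
qed (auto simp: cancel relator)

context premaniplex
begin

context
  fixes rn :: "'a \<Rightarrow> 'a"
  assumes rn: "pre_extender n K rn"
begin

lemma facet_gen_closed:
  "F \<in> facets n K \<Longrightarrow> facet_gen n K rn F \<in> carrier (extension_group n K rn)"
  by (auto simp: facet_gen_def extension_group_def presented_group_def)

lemma facet_gen_mult:
  assumes "F \<in> facets n K" "w \<in> lists (facets n K \<times> UNIV)"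
  defines "R \<equiv> {[(F, True), (rn ` F, True)] | F. F \<in> facets n K}"
  shows "facet_gen n K rn F \<otimes>\<^bsub>extension_group n K rn\<^esub> word_class (facets n K) R w =
    word_class (facets n K) R ((F, True) # w)"
  using assms word_class_mult[of "[(F, True)]" "facets n K" w R]
  by (simp add: facet_gen_def extension_group_def)

lemma facet_gen_inverse:
  assumes F: "F \<in> facets n K" and \<gamma>: "\<gamma> \<in> carrier (extension_group n K rn)"
  defines "G \<equiv> extension_group n K rn"
  shows "facet_gen n K rn (rn ` F) \<otimes>\<^bsub>G\<^esub> (facet_gen n K rn F \<otimes>\<^bsub>G\<^esub> \<gamma>) = \<gamma>"
proof -
  let ?R = "{[(F, True), (rn ` F, True)] | F. F \<in> facets n K}"
  obtain w where w: "w \<in> lists (facets n K \<times> UNIV)" "\<gamma> = word_class (facets n K) ?R w"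
    using \<gamma> by (auto simp: extension_group_def presented_group_def)
  have F': "rn ` F \<in> facets n K" by (rule pre_extender_image_facet[OF rn F])
  \<comment> \<open>This is the relator indexed by the image of \<open>F\<close>; its second letter
    is \<open>F\<close> because \<open>rn\<close> is an involution.\<close>
  have "[(rn ` F, True), (F, True)] \<in> ?R"
    using F' pre_extender_image_image[OF rn facet_subset[OF F]] by force
  then have "pres_eq (facets n K) ?R [(rn ` F, True), (F, True)] []"
    using F F' by (intro pres_relator) auto
  from pres_append[OF this pres_refl[OF w(1)]]
  have "word_class (facets n K) ?R ((rn ` F, True) # (F, True) # w) = \<gamma>"
    using w by (simp add: word_class_eqI)
  then show ?thesis
    unfolding G_def w(2) using F F' w(1) by (simp add: facet_gen_mult)
qed

lemma extension_group_one:
  "\<one>\<^bsub>extension_group n K rn\<^esub> \<in> carrier (extension_group n K rn)"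
  unfolding extension_group_def by (rule group.is_monoid[OF group_presented_group, THEN monoid.one_closed])

lemma facet_gen_mult_closed:
  assumes "F \<in> facets n K" "\<gamma> \<in> carrier (extension_group n K rn)"
  shows "facet_gen n K rn F \<otimes>\<^bsub>extension_group n K rn\<^esub> \<gamma> \<in> carrier (extension_group n K rn)"
proof -
  interpret group "extension_group n K rn"
    unfolding extension_group_def by (rule group_presented_group)
  show ?thesis using assms facet_gen_closed by simp
qed

text \<open>Inverse letters are not needed since the inverse of a generator is again a generator.\<close>

lemma extension_group_induct :
  assumes \<gamma>: "\<gamma> \<in> carrier (extension_group n K rn)"
    and one: "P \<one>\<^bsub>extension_group n K rn\<^esub>"
    and gen: "\<And>F \<gamma>. F \<in> facets n K \<Longrightarrow> \<gamma> \<in> carrier (extension_group n K rn) \<Longrightarrow> P \<gamma> \<Longrightarrow>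
      P (facet_gen n K rn F \<otimes>\<^bsub>extension_group n K rn\<^esub> \<gamma>)"
  shows "P \<gamma>"
proof -
  let ?R = "{[(F, True), (rn ` F, True)] | F. F \<in> facets n K}"
  let ?c = "word_class (facets n K) ?R"
  have mem: "?c w \<in> carrier (extension_group n K rn)" if "w \<in> lists (facets n K \<times> UNIV)" for w
    using that by (simp add: extension_group_def presented_group_def)
  obtain w where "w \<in> lists (facets n K \<times> UNIV)" "\<gamma> = ?c w"
    using \<gamma> by (auto simp: extension_group_def presented_group_def)
  moreover have "P (?c w)" if "w \<in> lists (facets n K \<times> UNIV)" for w
    using that
  proof (induction w)
    case Nil
    then show ?case using one by (simp add: extension_group_def presented_group_def)
  next
    case (Cons l w)
    then obtain F b where l: "l = (F, b)" "F \<in> facets n K" and w: "w \<in> lists (facets n K \<times> UNIV)"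
      by auto
    show ?case
    proof (cases b)
      case True
      then show ?thesis using gen[OF l(2) mem[OF w] Cons.IH] facet_gen_mult l w by simp
    next
      case False
      \<comment> \<open>Multiplying the class of \<open>l # w\<close> by the generator of
        \<open>F\<close> gives the class of \<open>w\<close>. Hence the inverse letter acts as the
        generator of the image of \<open>F\<close>, to which \<open>gen\<close> applies.\<close>
      let ?l = "(F, True)"
      have F': "rn ` F \<in> facets n K" by (rule pre_extender_image_facet[OF rn l(2)])
      have lw: "l # w \<in> lists (facets n K \<times> UNIV)" using l w by simp
      have "pres_eq (facets n K) ?R [?l, l] []" using pres_cancel[of F "facets n K" ?R True] l False by simp
      from pres_append[OF this pres_refl[OF w]]
      have "facet_gen n K rn F \<otimes>\<^bsub>extension_group n K rn\<^esub> ?c (l # w) = ?c w"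
        using facet_gen_mult[OF l(2) lw] by (simp add: word_class_eqI)
      then have "facet_gen n K rn (rn ` F) \<otimes>\<^bsub>extension_group n K rn\<^esub> ?c w = ?c (l # w)"
        using facet_gen_inverse[OF l(2) mem[OF lw]] by simp
      then show ?thesis using gen[OF F' mem[OF w] Cons.IH] w by simp
    qed
  qed
  ultimately show ?thesis by simp
qed

text \<open>The condition \<open>inverse\<close> says that the operations \<open>P F\<close> respect
  the relators, so they define an action of the extension group on \<open>W\<close>;
  \<open>st\<close> is the orbit map of \<open>s\<close>.\<close>

lemma extension_group_orbit_map:
  fixes P :: "'a set \<Rightarrow> 's \<Rightarrow> 's"
  assumes closed: "\<And>F s. F \<in> facets n K \<Longrightarrow> s \<in> W \<Longrightarrow> P F s \<in> W"
    and inverse: "\<And>F s. F \<in> facets n K \<Longrightarrow> s \<in> W \<Longrightarrow> P (rn ` F) (P F s) = s"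
    and s: "s \<in> W"
  obtains st where "st \<one>\<^bsub>extension_group n K rn\<^esub> = s"
    and "\<And>\<gamma>. \<gamma> \<in> carrier (extension_group n K rn) \<Longrightarrow> st \<gamma> \<in> W"
    and "\<And>F \<gamma>. F \<in> facets n K \<Longrightarrow> \<gamma> \<in> carrier (extension_group n K rn) \<Longrightarrow>
      st (facet_gen n K rn F \<otimes>\<^bsub>extension_group n K rn\<^esub> \<gamma>) = P F (st \<gamma>)"
proof -
  let ?R = "{[(F, True), (rn ` F, True)] | F. F \<in> facets n K}"
  let ?c = "word_class (facets n K) ?R"
  let ?L = "lists (facets n K \<times> (UNIV :: bool set))"
  \<comment> \<open>An inverse letter acts by \<open>P\<close> at the image facet, which inverts
    \<open>P F\<close>.\<close>
  define A where "A = (\<lambda>(F, b). P (if b then F else rn ` F))"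
  \<comment> \<open>Group elements are classes of words; an arbitrary representative is used, and
    \<open>fold\<close> shows that the choice does not matter.\<close>
  define st where "st \<gamma> = foldr A (SOME w. w \<in> \<gamma>) s" for \<gamma>
  have inverse': "P F (P (rn ` F) s) = s" if "F \<in> facets n K" "s \<in> W" for F s
    using inverse[OF pre_extender_image_facet[OF rn that(1)] that(2)]
      pre_extender_image_image[OF rn facet_subset[OF that(1)]] by simp
  have fold: "foldr A u s = foldr A v s \<and> foldr A u s \<in> W" if "pres_eq (facets n K) ?R u v" for u v
    using that
  proof (rule pres_eq_foldr)
    show "foldr A r s = s" if r: "r \<in> ?R" and "s \<in> W" for r s
      using that inverse' by (auto simp: A_def)
  qed (auto simp: A_def closed inverse inverse' pre_extender_image_facet[OF rn] s)
  have st: "st (?c w) = foldr A w s \<and> st (?c w) \<in> W" if w: "w \<in> ?L" for w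
  proof -
    have "w \<in> ?c w" using pres_refl[OF w] by (simp add: word_class_def)
    then have "(SOME w'. w' \<in> ?c w) \<in> ?c w" by (rule someI)
    then have "pres_eq (facets n K) ?R w (SOME w'. w' \<in> ?c w)" by (simp add: word_class_def)
    from fold[OF this] show ?thesis unfolding st_def by metis
  qed
  have car: "carrier (extension_group n K rn) = ?c ` ?L"
    and one: "\<one>\<^bsub>extension_group n K rn\<^esub> = ?c []"
    by (simp_all add: extension_group_def presented_group_def)
  show ?thesis
  proof
    show "st \<one>\<^bsub>extension_group n K rn\<^esub> = s" using st[of "[]"] one by simp
    show "st \<gamma> \<in> W" if "\<gamma> \<in> carrier (extension_group n K rn)" for \<gamma>
      using that st unfolding car by blast
    show "st (facet_gen n K rn F \<otimes>\<^bsub>extension_group n K rn\<^esub> \<gamma>) = P F (st \<gamma>)"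
      if F: "F \<in> facets n K" and \<gamma>: "\<gamma> \<in> carrier (extension_group n K rn)" for F \<gamma>
    proof -
      obtain w where w: "w \<in> ?L" "\<gamma> = ?c w" using \<gamma> unfolding car by blast
      then have "(F, True) # w \<in> ?L" using F by simp
      from st[OF this] st[OF w(1)] show ?thesis
        unfolding w(2) facet_gen_mult[OF F w(1)] by (simp add: A_def)
    qed
  qed
qed

end

end


section \<open>Isomorphisms between universal Cayley extensions\<close>

lemma flags_universal_cayley_extension [simp]:
  "flags (universal_cayley_extension n K rn) = flags K \<times> carrier (extension_group n K rn)"
  by (simp add: universal_cayley_extension_def)

lemma adj_universal_cayley_extension_lower [simp]:
  "i < n \<Longrightarrow> adj (universal_cayley_extension n K rn) i (\<Phi>, \<gamma>) = (adj K i \<Phi>, \<gamma>)"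
  by (simp add: universal_cayley_extension_def)

lemma adj_universal_cayley_extension_top [simp]:
  "adj (universal_cayley_extension n K rn) n (\<Phi>, \<gamma>) =
    (rn \<Phi>, facet_gen n K rn (facet_of n K \<Phi>) \<otimes>\<^bsub>extension_group n K rn\<^esub> \<gamma>)"
  by (simp add: universal_cayley_extension_def)

context maniplex
begin

section \<open>From extendable facet isomorphisms to isomorphic extensions\<close>

text \<open>Induction on the group element: an edge of colour \<open>n\<close> carries the
  fixed-point property into a new copy of \<open>K\<close>, and connectedness of \<open>K\<close>
  spreads it over that copy.\<close>

lemma universal_cayley_extension_rigid:
  assumes rn: "pre_extender n K rn"
  defines "U \<equiv> universal_cayley_extension n K rn"
  assumes adj: "\<And>i x. i < n + 1 \<Longrightarrow> x \<in> flags U \<Longrightarrow> h (adj U i x) = adj U i (h x)"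
    and base: "\<And>\<Phi>. \<Phi> \<in> flags K \<Longrightarrow> h (\<Phi>, \<one>\<^bsub>extension_group n K rn\<^esub>) = (\<Phi>, \<one>\<^bsub>extension_group n K rn\<^esub>)"
    and x: "x \<in> flags U"
  shows "h x = x"
proof -
  have "\<forall>\<Phi>\<in>flags K. h (\<Phi>, \<gamma>) = (\<Phi>, \<gamma>)" if "\<gamma> \<in> carrier (extension_group n K rn)" for \<gamma>
    using that
  proof (induction rule: extension_group_induct[OF rn, consumes 1, case_names one gen])
    case one
    then show ?case using base by simp
  next
    case (gen F \<gamma>)
    let ?\<gamma>' = "facet_gen n K rn F \<otimes>\<^bsub>extension_group n K rn\<^esub> \<gamma>"
    have \<gamma>': "?\<gamma>' \<in> carrier (extension_group n K rn)"
      using facet_gen_mult_closed[OF rn] gen by blast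
    \<comment> \<open>At any flag \<open>\<Psi>\<close> of \<open>F\<close>, the edge of colour
      \<open>n\<close> leads from the copy \<open>\<gamma>\<close> into the copy
      \<open>?\<gamma>'\<close>, entering it at \<open>rn \<Psi>\<close>.\<close>
    obtain \<Psi> where \<Psi>: "\<Psi> \<in> F" using facet_nonempty[OF gen(1)] by blast
    then have \<Psi>K: "\<Psi> \<in> flags K" using facet_subset[OF gen(1)] by blast
    have b: "h (rn \<Psi>, ?\<gamma>') = (rn \<Psi>, ?\<gamma>')"
      using adj[of n "(\<Psi>, \<gamma>)"] gen \<Psi>K facet_of_eq[OF gen(1) \<Psi>] by (simp add: U_def)
    show ?case
    proof
      fix \<Phi> assume "\<Phi> \<in> flags K"
      with pre_extender_closed[OF rn \<Psi>K] show "h (\<Phi>, ?\<gamma>') = (\<Phi>, ?\<gamma>')"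
      proof (induction rule: flag_induct)
        case (step i \<Theta>)
        then show ?case using adj[of i "(\<Theta>, ?\<gamma>')"] \<gamma>' by (simp add: U_def)
      qed (fact b)
    qed
  qed
  then show ?thesis using x by (auto simp: U_def)
qed

lemma universal_cayley_extension_map:
  assumes ext: "facet_isos_extend n K"
    and rn: "pre_extender n K rn" and rn': "pre_extender n K rn'"
  defines "U \<equiv> universal_cayley_extension n K rn" and "U' \<equiv> universal_cayley_extension n K rn'"
  obtains f where "\<And>x. x \<in> flags U \<Longrightarrow> f x \<in> flags U'"
    and "\<And>i x. i < n + 1 \<Longrightarrow> x \<in> flags U \<Longrightarrow> f (adj U i x) = adj U' i (f x)"
    and "\<And>\<Phi>. \<Phi> \<in> flags K \<Longrightarrow>
      f (\<Phi>, \<one>\<^bsub>extension_group n K rn\<^esub>) = (\<Phi>, \<one>\<^bsub>extension_group n K rn'\<^esub>)"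
proof -
  let ?G = "extension_group n K rn" and ?G' = "extension_group n K rn'"
  let ?\<Gamma> = "automorphisms n K"
  define c where "c \<tau> F = (SOME \<tau>'. \<tau>' \<in> ?\<Gamma> \<and> (\<forall>\<Phi>\<in>F. \<tau>' (rn \<Phi>) = rn' (\<tau> \<Phi>)))" for \<tau> F
  have c: "c \<tau> F \<in> ?\<Gamma>" "\<And>\<Phi>. \<Phi> \<in> F \<Longrightarrow> c \<tau> F (rn \<Phi>) = rn' (\<tau> \<Phi>)"
    if "\<tau> \<in> ?\<Gamma>" "F \<in> facets n K" for \<tau> F
  proof -
    have "\<exists>\<tau>'. \<tau>' \<in> ?\<Gamma> \<and> (\<forall>\<Phi>\<in>F. \<tau>' (rn \<Phi>) = rn' (\<tau> \<Phi>))"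
      using conjugate_automorphism_ex[OF ext rn rn' that] by blast
    from someI_ex[OF this]
    show "c \<tau> F \<in> ?\<Gamma>" "\<And>\<Phi>. \<Phi> \<in> F \<Longrightarrow> c \<tau> F (rn \<Phi>) = rn' (\<tau> \<Phi>)"
      unfolding c_def by blast+
  qed
  \<comment> \<open>This is the relator condition on the automorphism coordinate. One flag of
    \<open>F\<close> suffices, by \<open>automorphism_unique\<close>.\<close>
  have c_back: "c (c \<tau> F) (rn ` F) = \<tau>" if \<tau>: "\<tau> \<in> ?\<Gamma>" and F: "F \<in> facets n K" for \<tau> F
  proof -
    note F' = pre_extender_image_facet[OF rn F]
    obtain \<Phi> where \<Phi>: "\<Phi> \<in> F" using facet_nonempty[OF F] by blast
    then have \<Phi>K: "\<Phi> \<in> flags K" using facet_subset[OF F] by blast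
    have "c (c \<tau> F) (rn ` F) (rn (rn \<Phi>)) = rn' (rn' (\<tau> \<Phi>))"
      using c(2)[OF c(1)[OF \<tau> F] F', of "rn \<Phi>"] c(2)[OF \<tau> F \<Phi>] \<Phi> by simp
    then have "c (c \<tau> F) (rn ` F) \<Phi> = \<tau> \<Phi>"
      using pre_extender.invol[OF rn \<Phi>K] pre_extender.invol[OF rn' isos_closed[OF \<tau> \<Phi>K]] by simp
    then show ?thesis
      using automorphism_unique[OF c(1)[OF c(1)[OF \<tau> F] F'] \<tau> \<Phi>K] by blast
  qed
  \<comment> \<open>Needed for the group coordinate: it makes the second generator the one attached
    to the image of \<open>\<tau>\<close> under \<open>rn'\<close> on \<open>F\<close>, which
    cancels the first.\<close>
  have c_image: "c \<tau> F ` rn ` F = rn' ` \<tau> ` F" if \<tau>: "\<tau> \<in> ?\<Gamma>" and F: "F \<in> facets n K" for \<tau> F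
    using c(2)[OF \<tau> F] by (simp add: image_image)
  \<comment> \<open>A pair \<open>(\<tau>, g)\<close> describes a copy of \<open>K\<close> being
    carried by \<open>\<tau>\<close> onto the copy indexed by \<open>g\<close>; \<open>P F\<close>
    updates it on crossing the facet \<open>F\<close>.\<close>
  define P where
    "P F = (\<lambda>(\<tau>, g). (c \<tau> F, facet_gen n K rn' (\<tau> ` F) \<otimes>\<^bsub>?G'\<^esub> g))" for F
  \<comment> \<open>Automorphisms are extensional, so the identity has to be restricted.\<close>
  define e where "e = restrict (\<lambda>\<Phi>. \<Phi>) (flags K)"
  have e: "e \<in> ?\<Gamma>" by (rule automorphismI) (auto simp: e_def adj_closed inj_on_def)
  have "P F s \<in> ?\<Gamma> \<times> carrier ?G'" if "F \<in> facets n K" "s \<in> ?\<Gamma> \<times> carrier ?G'" for F s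
    using that c(1) facet_gen_mult_closed[OF rn'] automorphism_image_facet by (auto simp: P_def)
  moreover have "P (rn ` F) (P F s) = s" if "F \<in> facets n K" "s \<in> ?\<Gamma> \<times> carrier ?G'" for F s
    using that c_back c_image facet_gen_inverse[OF rn'] automorphism_image_facet
    by (auto simp: P_def)
  moreover have "(e, \<one>\<^bsub>?G'\<^esub>) \<in> ?\<Gamma> \<times> carrier ?G'"
    using e extension_group_one[OF rn'] by simp
  ultimately obtain st where st: "st \<one>\<^bsub>?G\<^esub> = (e, \<one>\<^bsub>?G'\<^esub>)"
    "\<And>\<gamma>. \<gamma> \<in> carrier ?G \<Longrightarrow> st \<gamma> \<in> ?\<Gamma> \<times> carrier ?G'"
    "\<And>F \<gamma>. F \<in> facets n K \<Longrightarrow> \<gamma> \<in> carrier ?G \<Longrightarrow>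
      st (facet_gen n K rn F \<otimes>\<^bsub>?G\<^esub> \<gamma>) = P F (st \<gamma>)"
    by (rule extension_group_orbit_map[OF rn, where P = P]) blast+
  define f where "f = (\<lambda>(\<Phi>, \<gamma>). (fst (st \<gamma>) \<Phi>, snd (st \<gamma>)))"
  have \<Gamma>: "fst (st \<gamma>) \<in> ?\<Gamma>" "snd (st \<gamma>) \<in> carrier ?G'" if "\<gamma> \<in> carrier ?G" for \<gamma>
    using st(2)[OF that] by (auto simp: mem_Times_iff)
  show ?thesis
  proof
    show "f x \<in> flags U'" if "x \<in> flags U" for x
      using that \<Gamma> isos_closed by (fastforce simp: U_def U'_def f_def)
    show "f (\<Phi>, \<one>\<^bsub>?G\<^esub>) = (\<Phi>, \<one>\<^bsub>?G'\<^esub>)" if "\<Phi> \<in> flags K" for \<Phi>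
      using that by (simp add: f_def st(1) e_def)
    fix i x assume i: "i < n + 1" and "x \<in> flags U"
    then obtain \<Phi> \<gamma> where x: "x = (\<Phi>, \<gamma>)" "\<Phi> \<in> flags K" "\<gamma> \<in> carrier ?G"
      by (auto simp: U_def)
    show "f (adj U i x) = adj U' i (f x)"
    proof (cases "i < n")
      case True
      then show ?thesis using x isos_adj[OF \<Gamma>(1)[OF x(3)]] by (simp add: U_def U'_def f_def)
    next
      case False
      then have [simp]: "i = n" using i by simp
      \<comment> \<open>Crossing at \<open>\<Phi>\<close> applies \<open>P\<close> for its facet.
        The automorphism of the copy sends this facet to that of the image flag, whose generator
        \<open>U'\<close> uses.\<close>
      note F = facet_of_mem[OF x(2)]
      show ?thesis
        using x st(3)[OF F x(3)] c(2)[OF \<Gamma>(1)[OF x(3)] F mem_facet_of]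
          automorphism_image_facet_of[OF \<Gamma>(1)[OF x(3)] x(2)]
        by (simp add: U_def U'_def f_def P_def split_beta)
    qed
  qed
qed

lemma universal_extensions_isomorphic_if_facet_isos_extend:
  assumes ext: "facet_isos_extend n K"
  shows "universal_extensions_isomorphic n K"
  unfolding universal_extensions_isomorphic_def
proof (intro allI impI)
  fix rn rn' assume rn: "pre_extender n K rn" and rn': "pre_extender n K rn'"
  let ?U = "universal_cayley_extension n K rn" and ?U' = "universal_cayley_extension n K rn'"
  interpret U: premaniplex "n + 1" ?U
    by (rule premaniplex_universal_cayley_extension[OF premaniplex_axioms rn])
  interpret U': premaniplex "n + 1" ?U'
    by (rule premaniplex_universal_cayley_extension[OF premaniplex_axioms rn'])
  obtain f where f: "\<And>x. x \<in> flags ?U \<Longrightarrow> f x \<in> flags ?U'"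
    "\<And>i x. i < n + 1 \<Longrightarrow> x \<in> flags ?U \<Longrightarrow> f (adj ?U i x) = adj ?U' i (f x)"
    "\<And>\<Phi>. \<Phi> \<in> flags K \<Longrightarrow>
      f (\<Phi>, \<one>\<^bsub>extension_group n K rn\<^esub>) = (\<Phi>, \<one>\<^bsub>extension_group n K rn'\<^esub>)"
    using universal_cayley_extension_map[OF ext rn rn'] by blast
  obtain g where g: "\<And>x. x \<in> flags ?U' \<Longrightarrow> g x \<in> flags ?U"
    "\<And>i x. i < n + 1 \<Longrightarrow> x \<in> flags ?U' \<Longrightarrow> g (adj ?U' i x) = adj ?U i (g x)"
    "\<And>\<Phi>. \<Phi> \<in> flags K \<Longrightarrow>
      g (\<Phi>, \<one>\<^bsub>extension_group n K rn'\<^esub>) = (\<Phi>, \<one>\<^bsub>extension_group n K rn\<^esub>)"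
    using universal_cayley_extension_map[OF ext rn' rn] by blast
  have "g (f x) = x" if "x \<in> flags ?U" for x
    by (rule universal_cayley_extension_rigid[OF rn _ _ that, where h = "\<lambda>x. g (f x)"])
      (use f g in metis)+
  moreover have "f (g x) = x" if "x \<in> flags ?U'" for x
    by (rule universal_cayley_extension_rigid[OF rn' _ _ that, where h = "\<lambda>x. f (g x)"])
      (use f g in metis)+
  ultimately have "bij_betw f (flags ?U) (flags ?U')"
    using f(1) g(1) by (intro bij_betw_byWitness[where f' = g]) blast+
  then have "restrict f (flags ?U) \<in> isos (n + 1) ?U ?U'"
    using f(2) U.adj_closed
    by (auto simp: isos_def cong: bij_betw_cong simp del: flags_universal_cayley_extension)
  then show "isomorphic (n + 1) ?U ?U'" unfolding isomorphic_def by blast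
qed

section \<open>From isomorphic extensions to extendable facet isomorphisms\<close>

lemma pre_extender_extends_if_isomorphic:
  assumes rn: "pre_extender n K rn"
    and iso: "isomorphic (n + 1) (universal_cayley_extension n K rn)
      (universal_cayley_extension n K (\<lambda>\<Phi>. \<Phi>))"
    and F: "F \<in> facets n K"
  shows "extends_to_automorphism n K F rn"
proof -
  let ?U = "universal_cayley_extension n K rn" and ?I = "universal_cayley_extension n K (\<lambda>\<Phi>. \<Phi>)"
  let ?G = "extension_group n K rn"
  obtain f where f: "f \<in> isos (n + 1) ?U ?I" using iso by (auto simp: isomorphic_def)
  define t where "t \<gamma> = restrict (\<lambda>\<Phi>. fst (f (\<Phi>, \<gamma>))) (flags K)" for \<gamma>
  have f_adj: "f (adj K i \<Phi>, \<gamma>) = (adj K i (fst (f (\<Phi>, \<gamma>))), snd (f (\<Phi>, \<gamma>)))"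
    if "i < n" "\<Phi> \<in> flags K" "\<gamma> \<in> carrier ?G" for i \<Phi> \<gamma>
    using that isos_adj[OF f, of i "(\<Phi>, \<gamma>)"] by (cases "f (\<Phi>, \<gamma>)") simp
  have f_closed: "fst (f (\<Phi>, \<gamma>)) \<in> flags K" if "\<Phi> \<in> flags K" "\<gamma> \<in> carrier ?G" for \<Phi> \<gamma>
    using that isos_closed[OF f, of "(\<Phi>, \<gamma>)"] by (cases "f (\<Phi>, \<gamma>)") simp
  have t: "t \<gamma> \<in> automorphisms n K" if \<gamma>: "\<gamma> \<in> carrier ?G" for \<gamma>
  proof (rule automorphismI)
    show "inj_on (t \<gamma>) (flags K)"
    proof (rule inj_onI)
      fix \<Phi> \<Psi> assume \<Phi>: "\<Phi> \<in> flags K" and \<Psi>: "\<Psi> \<in> flags K" and eq: "t \<gamma> \<Phi> = t \<gamma> \<Psi>"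
      \<comment> \<open>Colours below \<open>n\<close> keep the second coordinate, so it is constant
        on the image of a connected copy of \<open>K\<close>. Injectivity of \<open>f\<close> then
        passes to its first coordinate.\<close>
      have "snd (f (\<Psi>, \<gamma>)) = snd (f (\<Phi>, \<gamma>))"
        using \<Phi> \<Psi> by (induction rule: flag_induct) (simp_all add: f_adj \<gamma>)
      then have "f (\<Phi>, \<gamma>) = f (\<Psi>, \<gamma>)" using eq \<Phi> \<Psi> by (simp add: t_def prod_eq_iff)
      then show "\<Phi> = \<Psi>"
        using isos_bij[OF f] \<Phi> \<Psi> \<gamma> by (auto simp: bij_betw_def dest: inj_onD)
    qed
  qed (simp_all add: t_def f_closed f_adj adj_closed \<gamma>)
  \<comment> \<open>Index of the copy reached from the base copy by crossing
    \<open>F\<close>.\<close>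
  let ?a = "facet_gen n K rn F \<otimes>\<^bsub>?G\<^esub> \<one>\<^bsub>?G\<^esub>"
  have one: "\<one>\<^bsub>?G\<^esub> \<in> carrier ?G" by (rule extension_group_one[OF rn])
  have a: "?a \<in> carrier ?G" using facet_gen_mult_closed[OF rn F one] .
  \<comment> \<open>For the identity pre-extender, edges of colour \<open>n\<close> keep the first
    coordinate.\<close>
  have top: "t ?a (rn \<Phi>) = t \<one>\<^bsub>?G\<^esub> \<Phi>" if "\<Phi> \<in> F" for \<Phi>
  proof -
    have \<Phi>: "\<Phi> \<in> flags K" using that facet_subset[OF F] by blast
    have "f (rn \<Phi>, ?a) = adj ?I n (f (\<Phi>, \<one>\<^bsub>?G\<^esub>))"
      using isos_adj[OF f, of n "(\<Phi>, \<one>\<^bsub>?G\<^esub>)"] \<Phi> one facet_of_eq[OF F that] by simp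
    then show ?thesis
      using \<Phi> pre_extender_closed[OF rn \<Phi>] by (cases "f (\<Phi>, \<one>\<^bsub>?G\<^esub>)") (simp add: t_def)
  qed
  define \<tau> where
    "\<tau> = compose (flags K) (restrict (inv_into (flags K) (t ?a)) (flags K)) (t \<one>\<^bsub>?G\<^esub>)"
  have "\<tau> \<in> automorphisms n K"
    unfolding \<tau>_def
    by (rule isos_compose[OF premaniplex_axioms t[OF one]
          isos_inverse[OF premaniplex_axioms premaniplex_axioms t[OF a]]])
  moreover have "\<tau> \<Phi> = rn \<Phi>" if "\<Phi> \<in> F" for \<Phi>
  proof -
    have \<Phi>: "\<Phi> \<in> flags K" using that facet_subset[OF F] by blast
    then have "\<tau> \<Phi> = inv_into (flags K) (t ?a) (t ?a (rn \<Phi>))"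
      using isos_closed[OF t[OF one]] top[OF that] by (simp add: \<tau>_def compose_def)
    also have "\<dots> = rn \<Phi>"
      using isos_bij[OF t[OF a]] pre_extender_closed[OF rn \<Phi>] by (simp add: bij_betw_def inv_into_f_f)
    finally show ?thesis .
  qed
  ultimately show ?thesis unfolding extends_to_automorphism_def by blast
qed

lemma facet_isos_extend_if_universal_extensions_isomorphic:
  assumes "universal_extensions_isomorphic n K"
  shows "facet_isos_extend n K"
proof -
  have ext: "extends_to_automorphism n K F rn" if "pre_extender n K rn" "F \<in> facets n K" for rn F
    using assms that pre_extender_id pre_extender_extends_if_isomorphic
    unfolding universal_extensions_isomorphic_def by blast
  \<comment> \<open>Extendability depends only on values on \<open>F\<close>, where the
    pre-extenders built below agree with \<open>\<sigma>\<close>.\<close>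
  have cong: "extends_to_automorphism n K F \<sigma>"
    if "extends_to_automorphism n K F rn" "\<And>\<Phi>. \<Phi> \<in> F \<Longrightarrow> rn \<Phi> = \<sigma> \<Phi>" for F rn \<sigma>
    using that unfolding extends_to_automorphism_def by simp
  show ?thesis
    unfolding facet_isos_extend_def
  proof (intro conjI ballI impI)
    fix F F' \<sigma> assume "F \<in> facets n K" "F' \<in> facets n K" "F \<noteq> F'" "\<sigma> \<in> facet_isos n K F F'"
    from ext[OF pre_extender_of_swap[OF this] this(1)]
    show "extends_to_automorphism n K F \<sigma>" by (rule cong) simp
  next
    fix F \<sigma> assume F: "F \<in> facets n K" "\<sigma> \<in> facet_isos n K F F" and "\<forall>\<Phi>\<in>F. \<sigma> (\<sigma> \<Phi>) = \<Phi>"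
    then have "pre_extender n K (\<lambda>\<Phi>. if \<Phi> \<in> F then \<sigma> \<Phi> else \<Phi>)"
      by (intro pre_extender_of_involution) auto
    from ext[OF this F(1)] show "extends_to_automorphism n K F \<sigma>" by (rule cong) simp
  qed
qed

text \<open>In \<open>friendly\<close> the second automorphism may depend on the flag, so the one
  obtained for the facet of that flag suffices.\<close>

lemma friendly_if_facet_isos_extend:
  assumes "facet_isos_extend n K" "pre_extender n K rn"
  shows "friendly n K rn (automorphisms n K)"
  using conjugate_automorphism_ex[OF assms(1) assms(2) assms(2)] facet_of_mem mem_facet_of
  unfolding friendly_def by (metis order_refl)

end

theorem theorem5p25:
  fixes K :: "'a flag_graph" and n :: nat
  assumes "maniplex n K"
  shows "(universal_extensions_isomorphic n K \<longleftrightarrow> facet_isos_extend n K) \<and>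
    (facet_isos_extend n K \<longrightarrow>
      (\<forall>rn. pre_extender n K rn \<longrightarrow> friendly n K rn (automorphisms n K)))"
proof -
  interpret maniplex n K by fact
  show ?thesis
    using universal_extensions_isomorphic_if_facet_isos_extend
      facet_isos_extend_if_universal_extensions_isomorphic friendly_if_facet_isos_extend by blast
qed

end
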